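(* Let $0<a\le 1\le b$ and write $\mathcal{A}=\mathcal{A}_{a,b}:\mathbb{R}^n\to\mathbb{R}^n$. For $x,y\in\mathbb{R}^n\setminus\{0\}$ with $x\neq y$ put $$z=\frac{x}{|x|}\bigl(|x|+|x-y|\bigr),\qquad Q(x,y)=\frac{|\mathcal{A}(x)-\mathcal{A}(y)|}{|\mathcal{A}(x)-\mathcal{A}(z)|},$$ and let $$C(a,b)=\sup\{Q(x,y): x,y\in\mathbb{R}^n\setminus\{0\},\ x\ne y,\ |x|\le |y|\}.$$ Then $$C(a,b)=\frac{2}{3^a-1}\quad\text{and}\quad \lim_{a\to 1}C(a,b)=1.$$
   Context: $|\cdot|$ is the Euclidean norm on $\mathbb{R}^n$. For $a,b>0$ the map $\mathcal{A}_{a,b}$ on $\mathbb{R}^n$ is defined by $\mathcal{A}_{a,b}(x)=|x|^{a-1}x$ if $|x|<1$ (with value $0$ at $x=0$), and $\mathcal{A}_{a,b}(x)=|x|^{b-1}x$ if $|x|\ge 1$. *)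

theory Defs
  imports "HOL-Analysis.Analysis"
begin

definition radial_power :: "real \<Rightarrow> real \<Rightarrow> real ^ 'n \<Rightarrow> real ^ 'n" where
  "radial_power a b x =
     (if norm x < 1 then norm x powr (a - 1) *\<^sub>R x else norm x powr (b - 1) *\<^sub>R x)"

definition stretch_point :: "real ^ 'n \<Rightarrow> real ^ 'n \<Rightarrow> real ^ 'n" where
  "stretch_point x y = (norm x + norm (x - y)) *\<^sub>R (x /\<^sub>R norm x)"

definition distortion_quot :: "real \<Rightarrow> real \<Rightarrow> real ^ 'n \<Rightarrow> real ^ 'n \<Rightarrow> real" where
  "distortion_quot a b x y =
     norm (radial_power a b x - radial_power a b y) /
     norm (radial_power a b x - radial_power a b (stretch_point x y))"

(* The type argument carries the dimension n = CARD('n) >= 1. The supremum is taken in the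
   extended reals, so that finiteness of the constant is not presupposed. *)
definition distortion_const :: "'n::finite itself \<Rightarrow> real \<Rightarrow> real \<Rightarrow> ereal" where
  "distortion_const T a b =
     Sup {ereal (distortion_quot a b x y) | (x :: real ^ 'n) (y :: real ^ 'n).
            x \<noteq> 0 \<and> y \<noteq> 0 \<and> x \<noteq> y \<and> norm x \<le> norm y}"

end

theory Submission
  imports Defs
begin

text \<open>
  Write \<open>\<phi>(\<rho>)\<close> for the norm of the image of a vector of norm \<open>\<rho>\<close>, that is \<open>\<rho>\<^sup>a\<close> below \<open>1\<close> and
  \<open>\<rho>\<^sup>b\<close> from \<open>1\<close> on, and put \<open>r = \<bar>x\<bar>\<close>, \<open>s = \<bar>y\<bar>\<close>, \<open>t = \<bar>x - y\<bar>\<close>. The map keeps directions, so the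
  denominator of the quotient is \<open>\<phi>(r + t) - \<phi>(r)\<close>, and the law of cosines expresses the numerator
  by \<open>\<phi>(r)\<close>, \<open>\<phi>(s)\<close>, \<open>r\<close>, \<open>s\<close> and \<open>t\<close>.

  The two regimes of \<open>\<phi>\<close> need not be told apart. In logarithmic coordinates \<open>\<phi>\<close> is the maximum of
  two linear functions, hence convex, with all slopes at least \<open>a\<close>. So if \<open>\<alpha> \<ge> a\<close> is the slope of
  the chord from \<open>r\<close> to \<open>s\<close>, then \<open>\<phi>(s) = \<phi>(r) (s/r)\<^sup>\<alpha>\<close>, while
  \<open>\<phi>(r + t) \<ge> \<phi>(r) ((r + t)/r)\<^sup>\<alpha>\<close> because \<open>r + t \<ge> s\<close> (\<open>radial_profile_chord\<close>). Replacing \<open>\<phi>\<close>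
  by the pure power of exponent \<open>\<alpha>\<close> thus keeps the numerator and does not increase the denominator,
  and by homogeneity one may take \<open>r = 1\<close>.

  For a pure power and fixed \<open>t\<close>, the numerator is monotone in \<open>s \<ge> 1\<close>: decreasing if \<open>\<alpha> \<le> 1\<close>,
  increasing if \<open>\<alpha> \<ge> 1\<close>. This leaves the extreme values of \<open>s\<close> that the triangle inequality
  permits. If \<open>\<alpha> \<ge> 1\<close> the extreme case is \<open>s = 1 + t\<close>, where \<open>y\<close> is a multiple of \<open>x\<close> with quotient
  \<open>1\<close>. If \<open>\<alpha> \<le> 1\<close> it is \<open>s = 1\<close> for \<open>t \<le> 2\<close> and the antipodal direction \<open>s = t - 1\<close> for
  \<open>t \<ge> 2\<close>; in both the quotient is at most its value \<open>2 / (3\<^sup>\<alpha> - 1)\<close> at \<open>y = -x\<close>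
  (\<open>powr_chord_1_3\<close>, \<open>antipodal_powr_bound\<close>). All these bounds are at most \<open>2 / (3\<^sup>a - 1)\<close>,
  which is attained at \<open>y = -x\<close> when \<open>3 \<bar>x\<bar> < 1\<close>.
\<close>

section \<open>The homogeneous problem for a single power\<close>

text \<open>
  This is \<open>\<bar>\<bar>x\<bar>\<^sup>\<alpha>\<^sup>-\<^sup>1 x - \<bar>y\<bar>\<^sup>\<alpha>\<^sup>-\<^sup>1 y\<bar>\<^sup>2\<close> for \<open>\<bar>x\<bar> = 1\<close>, \<open>\<bar>y\<bar> = s\<close> and
  \<open>\<bar>x - y\<bar> = t\<close>, by the law of cosines.
\<close>

definition power_dist_sq :: "real \<Rightarrow> real \<Rightarrow> real \<Rightarrow> real" where
  "power_dist_sq \<alpha> t s = 1 + s powr (2 * \<alpha>) - s powr (\<alpha> - 1) * (1 + s\<^sup>2 - t\<^sup>2)"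

lemma power_dist_sq_deriv:
  assumes "0 < s"
  shows "(power_dist_sq \<alpha> t has_real_derivative
    s powr (\<alpha> - 2) * (2 * \<alpha> * s powr (\<alpha> + 1) - (1 - \<alpha>) * (t\<^sup>2 - 1) - (\<alpha> + 1) * s\<^sup>2)) (at s)"
proof -
  have e: "s powr (2 * \<alpha> - 1) = s powr (\<alpha> - 2) * s powr (\<alpha> + 1)"
    "s powr (\<alpha> - 1) = s powr (\<alpha> - 2) * s"
    using assms by (simp_all add: powr_add [symmetric] powr_mult_base mult.commute)
  have "(power_dist_sq \<alpha> t has_real_derivative
    2 * \<alpha> * s powr (2 * \<alpha> - 1) - ((\<alpha> - 1) * s powr (\<alpha> - 1 - 1) * (1 + s\<^sup>2 - t\<^sup>2)
      + s powr (\<alpha> - 1) * (2 * s))) (at s)"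
    unfolding power_dist_sq_def [abs_def]
    using assms by (auto intro!: derivative_eq_intros)
  then show ?thesis
    by (rule DERIV_cong) (simp add: e, simp add: algebra_simps power2_eq_square)
qed

text \<open>
  Both monotonicity statements come from comparing \<open>s\<^sup>\<alpha>\<^sup>+\<^sup>1\<close> with \<open>s\<^sup>2\<close> in the derivative: after this
  replacement its second factor becomes \<open>(\<alpha> - 1) (s\<^sup>2 + t\<^sup>2 - 1)\<close>, whose sign is that of \<open>\<alpha> - 1\<close>
  because \<open>s \<ge> 1\<close>.
\<close>

lemma power_dist_sq_antimono:
  assumes "0 < \<alpha>" "\<alpha> \<le> 1" "1 \<le> s" "s \<le> u"
  shows "power_dist_sq \<alpha> t u \<le> power_dist_sq \<alpha> t s"
proof (rule DERIV_nonpos_imp_nonincreasing [OF assms(4)])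
  fix v assume "s \<le> v" "v \<le> u"
  then have v: "1 \<le> v" using assms by simp
  have "v powr (\<alpha> + 1) \<le> v powr 2" using v assms by (intro powr_mono) auto
  then have p: "v powr (\<alpha> + 1) \<le> v\<^sup>2" using v by simp
  have "1 \<le> v\<^sup>2 + t\<^sup>2" using v by (intro add_increasing2) auto
  then have "0 \<le> (1 - \<alpha>) * (v\<^sup>2 + t\<^sup>2 - 1)" using assms by (intro mult_nonneg_nonneg) auto
  moreover have "2 * \<alpha> * v powr (\<alpha> + 1) \<le> 2 * \<alpha> * v\<^sup>2" using p assms by simp
  ultimately have "2 * \<alpha> * v powr (\<alpha> + 1) - (1 - \<alpha>) * (t\<^sup>2 - 1) - (\<alpha> + 1) * v\<^sup>2 \<le> 0"
    by (simp add: algebra_simps)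
  then show "\<exists>y. (power_dist_sq \<alpha> t has_real_derivative y) (at v) \<and> y \<le> 0"
    using power_dist_sq_deriv [of v \<alpha> t] v by (meson mult_nonneg_nonpos powr_ge_zero less_le_trans zero_less_one)
qed

lemma power_dist_sq_mono:
  assumes "1 \<le> \<alpha>" "1 \<le> s" "s \<le> u"
  shows "power_dist_sq \<alpha> t s \<le> power_dist_sq \<alpha> t u"
proof (rule DERIV_nonneg_imp_nondecreasing [OF assms(3)])
  fix v assume "s \<le> v" "v \<le> u"
  then have v: "1 \<le> v" using assms by simp
  have "v powr 2 \<le> v powr (\<alpha> + 1)" using v assms by (intro powr_mono) auto
  then have p: "v\<^sup>2 \<le> v powr (\<alpha> + 1)" using v by simp
  have "1 \<le> v\<^sup>2 + t\<^sup>2" using v by (intro add_increasing2) auto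
  then have "0 \<le> (\<alpha> - 1) * (v\<^sup>2 + t\<^sup>2 - 1)" using assms by (intro mult_nonneg_nonneg) auto
  moreover have "2 * \<alpha> * v\<^sup>2 \<le> 2 * \<alpha> * v powr (\<alpha> + 1)" using p assms by simp
  ultimately have "0 \<le> 2 * \<alpha> * v powr (\<alpha> + 1) - (1 - \<alpha>) * (t\<^sup>2 - 1) - (\<alpha> + 1) * v\<^sup>2"
    by (simp add: algebra_simps)
  then show "\<exists>y. (power_dist_sq \<alpha> t has_real_derivative y) (at v) \<and> 0 \<le> y"
    using power_dist_sq_deriv [of v \<alpha> t] v by (meson mult_nonneg_nonneg powr_ge_zero less_le_trans zero_less_one)
qed

lemma power_dist_sq_1: "power_dist_sq \<alpha> t 1 = t\<^sup>2"
  by (simp add: power_dist_sq_def)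

lemma power_dist_sq_antipodal:
  assumes "0 < s"
  shows "power_dist_sq \<alpha> (s + 1) s = (1 + s powr \<alpha>)\<^sup>2"
proof -
  have "s powr (\<alpha> - 1) * s = s powr \<alpha>" "s powr (2 * \<alpha>) = (s powr \<alpha>)\<^sup>2"
    using assms by (simp_all add: powr_mult_base mult.commute powr_powr [symmetric])
  then show ?thesis by (simp add: power_dist_sq_def power2_eq_square algebra_simps)
qed

lemma power_dist_sq_same_direction:
  assumes "0 < s"
  shows "power_dist_sq \<alpha> (s - 1) s = (s powr \<alpha> - 1)\<^sup>2"
proof -
  have "s powr (\<alpha> - 1) * s = s powr \<alpha>" "s powr (2 * \<alpha>) = (s powr \<alpha>)\<^sup>2"
    using assms by (simp_all add: powr_mult_base mult.commute powr_powr [symmetric])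
  then show ?thesis by (simp add: power_dist_sq_def power2_eq_square algebra_simps)
qed

text \<open>A concave power lies above its chord between the abscissae \<open>1\<close> and \<open>3\<close>.\<close>

lemma powr_chord_1_3:
  fixes t :: real
  assumes "0 < \<alpha>" "\<alpha> \<le> 1" "0 \<le> t" "t \<le> 2"
  shows "t * (3 powr \<alpha> - 1) \<le> 2 * ((1 + t) powr \<alpha> - 1)"
proof -
  have "concave_on {0<..} (\<lambda>x::real. x powr \<alpha>)"
  proof (rule f''_le0_imp_concave)
    fix x :: real assume x: "x \<in> {0<..}"
    show "((\<lambda>x. x powr \<alpha>) has_real_derivative \<alpha> * x powr (\<alpha> - 1)) (at x)"
      using x by (auto intro!: derivative_eq_intros)
    show "((\<lambda>x. \<alpha> * x powr (\<alpha> - 1)) has_real_derivative \<alpha> * ((\<alpha> - 1) * x powr (\<alpha> - 2))) (at x)"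
      using x by (auto intro!: derivative_eq_intros)
    show "\<alpha> * ((\<alpha> - 1) * x powr (\<alpha> - 2)) \<le> 0"
      using assms by (intro mult_nonneg_nonpos mult_nonpos_nonneg) auto
  qed simp
  moreover have "(1 - t / 2) * 1 + t / 2 * 3 = 1 + t" by simp
  ultimately have "(1 - t / 2) * 1 powr \<alpha> + t / 2 * 3 powr \<alpha> \<le> (1 + t) powr \<alpha>"
    using concave_onD [of "{0<..}" "\<lambda>x. x powr \<alpha>" "t / 2" 1 3] assms by (simp add: add.commute)
  then show ?thesis by (simp add: algebra_simps)
qed

text \<open>
  Equality holds at \<open>s = 1\<close>, and the difference of the two sides increases with \<open>s\<close>: the
  derivative is non-negative because \<open>(3\<^sup>\<alpha> - 1) ((s + 2) / s)\<^sup>1\<^sup>-\<^sup>\<alpha> \<le> (3\<^sup>\<alpha> - 1) 3\<^sup>1\<^sup>-\<^sup>\<alpha> = 3 - 3\<^sup>1\<^sup>-\<^sup>\<alpha> \<le> 2\<close>.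
\<close>

lemma antipodal_powr_bound:
  fixes s :: real
  assumes "0 < \<alpha>" "\<alpha> \<le> 1" "1 \<le> s"
  shows "(1 + s powr \<alpha>) * (3 powr \<alpha> - 1) \<le> 2 * ((s + 2) powr \<alpha> - 1)"
proof -
  define h where "h v = 2 * ((v + 2) powr \<alpha> - 1) - (1 + v powr \<alpha>) * (3 powr \<alpha> - 1)" for v :: real
  have "h 1 \<le> h s"
  proof (rule DERIV_nonneg_imp_nondecreasing [OF assms(3)])
    fix v assume "1 \<le> v" "v \<le> s"
    have "v powr (\<alpha> - 1) \<le> ((v + 2) / 3) powr (\<alpha> - 1)"
      using \<open>1 \<le> v\<close> assms by (intro powr_mono2') auto
    also have "\<dots> = (v + 2) powr (\<alpha> - 1) * 3 powr (1 - \<alpha>)"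
      using \<open>1 \<le> v\<close> by (simp add: powr_divide powr_minus_divide [of 3 "1 - \<alpha>", simplified])
    finally have "(3 powr \<alpha> - 1) * v powr (\<alpha> - 1)
        \<le> (3 powr \<alpha> - 1) * ((v + 2) powr (\<alpha> - 1) * 3 powr (1 - \<alpha>))"
      using assms by (intro mult_left_mono) (auto simp: ge_one_powr_ge_zero)
    also have "\<dots> = (3 - 3 powr (1 - \<alpha>)) * (v + 2) powr (\<alpha> - 1)"
    proof -
      have "3 powr \<alpha> * 3 powr (1 - \<alpha>) = (3::real)" by (simp add: powr_add [symmetric])
      moreover have "(3 powr \<alpha> - 1) * ((v + 2) powr (\<alpha> - 1) * 3 powr (1 - \<alpha>)) =
          (3 powr \<alpha> * 3 powr (1 - \<alpha>) - 3 powr (1 - \<alpha>)) * (v + 2) powr (\<alpha> - 1)"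
        by (simp only: algebra_simps)
      ultimately show ?thesis by simp
    qed
    also have "\<dots> \<le> 2 * (v + 2) powr (\<alpha> - 1)"
      using assms ge_one_powr_ge_zero [of 3 "1 - \<alpha>"] by (intro mult_right_mono) auto
    finally have "0 \<le> \<alpha> * (2 * (v + 2) powr (\<alpha> - 1) - (3 powr \<alpha> - 1) * v powr (\<alpha> - 1))"
      using assms by simp
    moreover have "(h has_real_derivative
        \<alpha> * (2 * (v + 2) powr (\<alpha> - 1) - (3 powr \<alpha> - 1) * v powr (\<alpha> - 1))) (at v)"
      unfolding h_def using \<open>1 \<le> v\<close>
      by (auto intro!: derivative_eq_intros simp: algebra_simps)
    ultimately show "\<exists>y. (h has_real_derivative y) (at v) \<and> 0 \<le> y" by blast
  qed
  then show ?thesis by (simp add: h_def)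
qed

lemma power_dist_sq_bound:
  assumes a: "0 < a" "a \<le> 1" "a \<le> \<alpha>" and s: "1 \<le> s" "s - 1 \<le> t" "t \<le> s + 1"
  shows "power_dist_sq \<alpha> t s \<le> (2 / (3 powr a - 1) * ((1 + t) powr \<alpha> - 1))\<^sup>2"
proof -
  have t: "0 \<le> t" using s by simp
  have gt1: "1 < 3 powr c" if "0 < c" for c :: real
    using powr_less_mono [of 0 c "3::real"] that by simp
  have inc: "0 \<le> (1 + t) powr \<alpha> - 1" using t a by (simp add: ge_one_powr_ge_zero)
  show ?thesis
  proof (cases "\<alpha> \<le> 1")
    case True
    have "power_dist_sq \<alpha> t s \<le> (2 / (3 powr \<alpha> - 1) * ((1 + t) powr \<alpha> - 1))\<^sup>2"
    proof (cases "t \<le> 2")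
      case True
      have "power_dist_sq \<alpha> t s \<le> t\<^sup>2"
        using power_dist_sq_antimono [of \<alpha> 1 s t] s a \<open>\<alpha> \<le> 1\<close> by (simp add: power_dist_sq_1)
      also have "t \<le> 2 / (3 powr \<alpha> - 1) * ((1 + t) powr \<alpha> - 1)"
        using powr_chord_1_3 [of \<alpha> t] True t a \<open>\<alpha> \<le> 1\<close> gt1 [of \<alpha>] by (simp add: field_simps)
      then have "t\<^sup>2 \<le> (2 / (3 powr \<alpha> - 1) * ((1 + t) powr \<alpha> - 1))\<^sup>2"
        using t by (rule power_mono)
      finally show ?thesis .
    next
      case False
      have "power_dist_sq \<alpha> t s \<le> power_dist_sq \<alpha> t (t - 1)"
        using False s a \<open>\<alpha> \<le> 1\<close> by (intro power_dist_sq_antimono) auto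
      also have "\<dots> = (1 + (t - 1) powr \<alpha>)\<^sup>2"
        using power_dist_sq_antipodal [of "t - 1" \<alpha>] False by simp
      also have "1 + (t - 1) powr \<alpha> \<le> 2 / (3 powr \<alpha> - 1) * ((1 + t) powr \<alpha> - 1)"
        using antipodal_powr_bound [of \<alpha> "t - 1"] False a \<open>\<alpha> \<le> 1\<close> gt1 [of \<alpha>]
        by (simp add: field_simps)
      then have "(1 + (t - 1) powr \<alpha>)\<^sup>2 \<le> (2 / (3 powr \<alpha> - 1) * ((1 + t) powr \<alpha> - 1))\<^sup>2"
        by (rule power_mono) simp
      finally show ?thesis .
    qed
    also have "\<dots> \<le> (2 / (3 powr a - 1) * ((1 + t) powr \<alpha> - 1))\<^sup>2"
    proof (rule power_mono)
      have "2 / (3 powr \<alpha> - 1) \<le> 2 / (3 powr a - 1)"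
        using gt1 [of a] gt1 [of \<alpha>] a by (intro divide_left_mono) auto
      then show "2 / (3 powr \<alpha> - 1) * ((1 + t) powr \<alpha> - 1) \<le> 2 / (3 powr a - 1) * ((1 + t) powr \<alpha> - 1)"
        using inc by (rule mult_right_mono)
      show "0 \<le> 2 / (3 powr \<alpha> - 1) * ((1 + t) powr \<alpha> - 1)"
        using gt1 [of \<alpha>] a by (intro mult_nonneg_nonneg inc divide_nonneg_nonneg) linarith+
    qed
    finally show ?thesis .
  next
    case False
    have "power_dist_sq \<alpha> t s \<le> power_dist_sq \<alpha> t (1 + t)"
      using False s by (intro power_dist_sq_mono) auto
    also have "\<dots> = ((1 + t) powr \<alpha> - 1)\<^sup>2"
      using power_dist_sq_same_direction [of "1 + t" \<alpha>] t by simp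
    also have "\<dots> \<le> (2 / (3 powr a - 1) * ((1 + t) powr \<alpha> - 1))\<^sup>2"
    proof (rule power_mono [OF _ inc])
      have "3 powr a \<le> 3 powr (1::real)" using a by (intro powr_mono) auto
      then have "1 \<le> 2 / (3 powr a - 1)" using gt1 [of a] a by simp
      from mult_right_mono [OF this inc]
      show "(1 + t) powr \<alpha> - 1 \<le> 2 / (3 powr a - 1) * ((1 + t) powr \<alpha> - 1)" by simp
    qed
    finally show ?thesis .
  qed
qed

section \<open>The radial profile\<close>

definition radial_profile :: "real \<Rightarrow> real \<Rightarrow> real \<Rightarrow> real" where
  "radial_profile a b \<rho> = (if \<rho> < 1 then \<rho> powr a else \<rho> powr b)"

lemma radial_profile_pos: "0 < \<rho> \<Longrightarrow> 0 < radial_profile a b \<rho>"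
  by (simp add: radial_profile_def)

lemma radial_profile_eq_max:
  assumes "a \<le> b" "0 < \<rho>"
  shows "radial_profile a b \<rho> = max (\<rho> powr a) (\<rho> powr b)"
proof (cases "\<rho> < 1")
  case True
  then have "\<rho> powr b \<le> \<rho> powr a" using assms by (intro powr_mono') auto
  then show ?thesis using True by (simp add: radial_profile_def)
next
  case False
  then have "\<rho> powr a \<le> \<rho> powr b" using assms by (intro powr_mono) auto
  then show ?thesis using False by (simp add: radial_profile_def)
qed

lemma radial_profile_growth:
  assumes "a \<le> b" "0 < r" "r \<le> u"
  shows "radial_profile a b r * (u / r) powr a \<le> radial_profile a b u"
proof (cases "r < 1")
  case True
  then show ?thesis using assms by (auto simp: radial_profile_def powr_divide intro!: powr_mono)
next
  case False
  have "(u / r) powr a \<le> (u / r) powr b" using assms by (intro powr_mono) auto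
  then have "r powr b * (u / r) powr a \<le> r powr b * (u / r) powr b" by (intro mult_left_mono) auto
  then show ?thesis using assms False by (simp add: radial_profile_def powr_divide)
qed

text \<open>
  In logarithmic coordinates the chord of the convex profile from \<open>r\<close> to \<open>s\<close> has slope \<open>\<alpha> \<ge> a\<close>,
  and its continuation beyond \<open>s\<close> stays below the profile.
\<close>

lemma radial_profile_chord:
  assumes "a \<le> b" "0 < r" "r \<le> s"
  obtains \<alpha> where "a \<le> \<alpha>"
    and "radial_profile a b s = radial_profile a b r * (s / r) powr \<alpha>"
    and "\<And>u. s \<le> u \<Longrightarrow> radial_profile a b r * (u / r) powr \<alpha> \<le> radial_profile a b u"
proof (cases "r = s")
  case True
  show ?thesis
    by (rule that [of a]) (use True assms radial_profile_growth [OF assms(1,2)] in auto)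
next
  case False
  let ?\<phi> = "radial_profile a b"
  have q: "1 < s / r" using False assms by simp
  have pos: "0 < ?\<phi> r" "0 < ?\<phi> s" using assms by (auto intro: radial_profile_pos)
  define \<alpha> where "\<alpha> = log (s / r) (?\<phi> s / ?\<phi> r)"
  have \<alpha>: "(s / r) powr \<alpha> = ?\<phi> s / ?\<phi> r"
    unfolding \<alpha>_def using q pos by (intro powr_log_cancel) auto
  \<comment> \<open>\<open>c\<close> is the slope of the linear piece that is active at \<open>s\<close>: a supporting line there.\<close>
  obtain c where c: "?\<phi> s = s powr c" "\<And>v. 0 < v \<Longrightarrow> v powr c \<le> ?\<phi> v"
  proof (cases "s < 1")
    case True
    then have "?\<phi> s = s powr a" by (simp add: radial_profile_def)
    then show ?thesis
      by (rule that) (use assms(1) in \<open>simp add: radial_profile_eq_max\<close>)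
  next
    case False
    then have "?\<phi> s = s powr b" by (simp add: radial_profile_def)
    then show ?thesis
      by (rule that) (use assms(1) in \<open>simp add: radial_profile_eq_max\<close>)
  qed
  have "(s / r) powr \<alpha> \<le> (s / r) powr c"
    unfolding \<alpha> using c(1) c(2) [of r] assms by (simp add: powr_divide frac_le)
  then have \<alpha>c: "\<alpha> \<le> c" using q by simp
  show ?thesis
  proof (rule that [of \<alpha>])
    have "(s / r) powr a \<le> (s / r) powr \<alpha>"
      using radial_profile_growth [OF assms] pos by (simp add: \<alpha> field_simps)
    then show "a \<le> \<alpha>" using q by simp
    show eq: "?\<phi> s = ?\<phi> r * (s / r) powr \<alpha>" using \<alpha> pos by simp
    fix u assume u: "s \<le> u"
    have "?\<phi> r * (u / r) powr \<alpha> = ?\<phi> s * (u / s) powr \<alpha>"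
      using eq u assms by (simp add: powr_divide)
    also have "\<dots> \<le> ?\<phi> s * (u / s) powr c"
      using pos u assms \<alpha>c by (intro mult_left_mono powr_mono) auto
    also have "\<dots> = u powr c" using c(1) u assms by (simp add: powr_divide)
    also have "\<dots> \<le> ?\<phi> u" using c(2) u assms by simp
    finally show "?\<phi> r * (u / r) powr \<alpha> \<le> ?\<phi> u" .
  qed
qed

section \<open>The distortion quotient\<close>

lemma radial_power_eq_profile:
  assumes "x \<noteq> 0"
  shows "radial_power a b x = (radial_profile a b (norm x) / norm x) *\<^sub>R x"
  using assms by (simp add: radial_power_def radial_profile_def powr_diff)

lemma radial_power_stretch_dist:
  assumes "0 < a" "a \<le> b" "x \<noteq> 0"
  shows "norm (radial_power a b x - radial_power a b (stretch_point x y)) =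
    radial_profile a b (norm x + norm (x - y)) - radial_profile a b (norm x)"
proof -
  let ?r = "norm x" and ?u = "norm x + norm (x - y)"
  let ?\<phi> = "radial_profile a b"
  have r: "0 < ?r" and u: "0 < ?u" using assms by (auto simp: add_pos_nonneg)
  have z: "stretch_point x y = (?u / ?r) *\<^sub>R x"
    by (simp add: stretch_point_def divide_inverse)
  have nz: "norm (stretch_point x y) = ?u"
    using r u by (simp add: z)
  then have "stretch_point x y \<noteq> 0" using u by auto
  then have "radial_power a b (stretch_point x y) = (?\<phi> ?u / ?r) *\<^sub>R x"
    using u by (simp add: radial_power_eq_profile nz) (simp add: z)
  then have "radial_power a b x - radial_power a b (stretch_point x y) = ((?\<phi> ?r - ?\<phi> ?u) / ?r) *\<^sub>R x"
    using assms by (simp add: radial_power_eq_profile scaleR_diff_left diff_divide_distrib)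
  then have "norm (radial_power a b x - radial_power a b (stretch_point x y)) = \<bar>?\<phi> ?r - ?\<phi> ?u\<bar>"
    using r by simp
  moreover have "1 \<le> (?u / ?r) powr a"
    using assms r by (intro ge_one_powr_ge_zero) auto
  then have "?\<phi> ?r * 1 \<le> ?\<phi> ?r * (?u / ?r) powr a"
    using radial_profile_pos [OF r, of a b] by (meson mult_left_mono less_imp_le)
  then have "?\<phi> ?r \<le> ?\<phi> ?u"
    using radial_profile_growth [OF assms(2) r, of ?u] by simp
  ultimately show ?thesis by simp
qed

text \<open>
  The law of cosines, for the images and for \<open>x\<close>, \<open>y\<close> themselves, written with the exponent \<open>\<alpha>\<close> of
  the chord from \<open>\<bar>x\<bar>\<close> to \<open>\<bar>y\<bar>\<close>.
\<close>

lemma radial_power_dist_sq: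
  assumes "x \<noteq> 0" "y \<noteq> 0"
    and "radial_profile a b (norm y) = radial_profile a b (norm x) * (norm y / norm x) powr \<alpha>"
  shows "(norm (radial_power a b x - radial_power a b y))\<^sup>2 =
    (radial_profile a b (norm x))\<^sup>2 * power_dist_sq \<alpha> (norm (x - y) / norm x) (norm y / norm x)"
proof -
  define r s t p q where "r = norm x" "s = norm y" "t = norm (x - y)"
    "p = radial_profile a b r" "q = (s / r) powr \<alpha>"
  note d = this
  have pos: "0 < r" "0 < s" using assms by (auto simp: d)
  have xy: "x \<bullet> x = r\<^sup>2" "y \<bullet> y = s\<^sup>2" "2 * (x \<bullet> y) = r\<^sup>2 + s\<^sup>2 - t\<^sup>2"
    by (simp_all add: d power2_norm_eq_inner inner_diff inner_commute)
  have A: "radial_power a b x = (p / r) *\<^sub>R x" "radial_power a b y = (p * q / s) *\<^sub>R y"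
    using assms by (simp_all add: radial_power_eq_profile d)
  have "(norm (radial_power a b x - radial_power a b y))\<^sup>2 =
      (p / r)\<^sup>2 * (x \<bullet> x) + (p * q / s)\<^sup>2 * (y \<bullet> y) - (p / r) * (p * q / s) * (2 * (x \<bullet> y))"
    unfolding A power2_norm_eq_inner
    by (simp add: inner_diff inner_commute power2_eq_square algebra_simps)
  also have "\<dots> = p\<^sup>2 * (1 + q\<^sup>2 - q / (s / r) * (1 + (s / r)\<^sup>2 - (t / r)\<^sup>2))"
  proof -
    have angle: "1 + (s / r)\<^sup>2 - (t / r)\<^sup>2 = (r\<^sup>2 + s\<^sup>2 - t\<^sup>2) / r\<^sup>2"
      using pos by (simp add: power_divide add_divide_distrib diff_divide_distrib)
    have "(p / r)\<^sup>2 * r\<^sup>2 = p\<^sup>2" "(p * q / s)\<^sup>2 * s\<^sup>2 = p\<^sup>2 * q\<^sup>2"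
      "p / r * (p * q / s) = p\<^sup>2 * (q / (s / r) / r\<^sup>2)"
      using pos by (simp_all add: power_divide power_mult_distrib power2_eq_square ac_simps)
    then have "(p / r)\<^sup>2 * r\<^sup>2 + (p * q / s)\<^sup>2 * s\<^sup>2 - p / r * (p * q / s) * (r\<^sup>2 + s\<^sup>2 - t\<^sup>2) =
        p\<^sup>2 + p\<^sup>2 * q\<^sup>2 - p\<^sup>2 * (q / (s / r) / r\<^sup>2) * (r\<^sup>2 + s\<^sup>2 - t\<^sup>2)"
      by (metis (no_types))
    also have "\<dots> = p\<^sup>2 * (1 + q\<^sup>2 - q / (s / r) * ((r\<^sup>2 + s\<^sup>2 - t\<^sup>2) / r\<^sup>2))"
    proof -
      have "k + k * m - k * (n / c) * w = k * (1 + m - n * (w / c))" for k m n c w :: real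
        by (simp add: algebra_simps)
      then show ?thesis .
    qed
    finally show ?thesis unfolding xy angle .
  qed
  also have "\<dots> = p\<^sup>2 * power_dist_sq \<alpha> (t / r) (s / r)"
  proof -
    have "(s / r) powr (2 * \<alpha>) = q\<^sup>2"
      unfolding d by (simp only: mult_2 powr_add power2_eq_square)
    moreover have "(s / r) powr (\<alpha> - 1) = q / (s / r)"
      using pos by (simp add: \<open>q = (s / r) powr \<alpha>\<close> powr_diff)
    ultimately show ?thesis by (simp only: power_dist_sq_def)
  qed
  finally show ?thesis by (simp add: d)
qed

lemma distortion_quot_le:
  assumes a: "0 < a" "a \<le> 1" "1 \<le> b"
    and xy: "x \<noteq> 0" "y \<noteq> 0" "norm x \<le> norm y"
  shows "distortion_quot a b x y \<le> 2 / (3 powr a - 1)"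
proof -
  define r s t where "r = norm x" "s = norm y" "t = norm (x - y)"
  note d = this
  let ?\<phi> = "radial_profile a b"
  let ?C = "2 / (3 powr a - 1)"
  have r: "0 < r" "r \<le> s" "0 \<le> t" using xy by (auto simp: d)
  have tri: "s \<le> r + t" "t \<le> r + s"
    using norm_triangle_ineq2 [of y x] norm_triangle_ineq4 [of x y] by (auto simp: d norm_minus_commute)
  have C: "0 < ?C" using powr_less_mono [of 0 a "3::real"] a by simp
  obtain \<alpha> where \<alpha>: "a \<le> \<alpha>" "?\<phi> s = ?\<phi> r * (s / r) powr \<alpha>"
    "\<And>u. s \<le> u \<Longrightarrow> ?\<phi> r * (u / r) powr \<alpha> \<le> ?\<phi> u"
    using radial_profile_chord [of a b r s] a r by auto
  have \<phi>r: "0 < ?\<phi> r" using r by (simp add: radial_profile_pos)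
  have "(norm (radial_power a b x - radial_power a b y))\<^sup>2 = (?\<phi> r)\<^sup>2 * power_dist_sq \<alpha> (t / r) (s / r)"
    using radial_power_dist_sq [OF xy(1,2)] \<alpha>(2) by (simp add: d)
  also have "\<dots> \<le> (?\<phi> r)\<^sup>2 * (?C * ((1 + t / r) powr \<alpha> - 1))\<^sup>2"
  proof (intro mult_left_mono power_dist_sq_bound)
    show "1 \<le> s / r" using r by simp
    show "s / r - 1 \<le> t / r"
      using divide_right_mono [of s "r + t" r] tri r by (simp add: add_divide_distrib)
    show "t / r \<le> s / r + 1"
      using divide_right_mono [of t "r + s" r] tri r by (simp add: add_divide_distrib)
  qed (use a \<alpha> in auto)
  also have "\<dots> = (?C * (?\<phi> r * ((r + t) / r) powr \<alpha> - ?\<phi> r))\<^sup>2"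
  proof -
    have "1 + t / r = (r + t) / r" using r by (simp add: add_divide_distrib)
    moreover have scale: "k * (c * (w - 1)) = c * (k * w - k)" for k c w :: real
      by (simp add: algebra_simps)
    ultimately show ?thesis by (simp only: power_mult_distrib [symmetric] scale)
  qed
  finally have sq: "(norm (radial_power a b x - radial_power a b y))\<^sup>2 \<le>
      (?C * (?\<phi> r * ((r + t) / r) powr \<alpha> - ?\<phi> r))\<^sup>2" .
  have "1 \<le> ((r + t) / r) powr \<alpha>" using r a \<alpha> by (intro ge_one_powr_ge_zero) auto
  then have nn: "0 \<le> ?\<phi> r * ((r + t) / r) powr \<alpha> - ?\<phi> r" using \<phi>r by simp
  have "norm (radial_power a b x - radial_power a b y) \<le> ?C * (?\<phi> r * ((r + t) / r) powr \<alpha> - ?\<phi> r)"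
    using sq by (rule power2_le_imp_le) (use C nn in simp)
  also have "\<dots> \<le> ?C * (?\<phi> (r + t) - ?\<phi> r)"
    using \<alpha>(3) [OF tri(1)] C by (intro mult_left_mono) auto
  finally have le: "norm (radial_power a b x - radial_power a b y) \<le> ?C * (?\<phi> (r + t) - ?\<phi> r)" .
  have "0 \<le> ?\<phi> (r + t) - ?\<phi> r" using \<alpha>(3) [OF tri(1)] nn by simp
  moreover have "distortion_quot a b x y =
      norm (radial_power a b x - radial_power a b y) / (?\<phi> (r + t) - ?\<phi> r)"
    unfolding distortion_quot_def using a xy by (simp add: radial_power_stretch_dist d)
  ultimately show ?thesis
    using le C by (cases "?\<phi> (r + t) = ?\<phi> r") (simp_all add: divide_le_eq)
qed

text \<open>
  The requirement \<open>3 \<bar>x\<bar> < 1\<close> keeps the stretched point in the region where the exponent is \<open>a\<close>.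
\<close>

lemma distortion_quot_antipodal:
  assumes "0 < a" "a \<le> b" "x \<noteq> 0" "3 * norm x < 1"
  shows "distortion_quot a b x (- x) = 2 / (3 powr a - 1)"
proof -
  define r where "r = norm x"
  have r: "0 < r" "3 * r < 1" using assms by (auto simp: r_def)
  have d: "norm (x - - x) = 2 * r"
    by (simp add: r_def flip: scaleR_2)
  have "radial_power a b x - radial_power a b (- x) = (2 * radial_profile a b r / r) *\<^sub>R x"
    using assms by (simp add: radial_power_eq_profile r_def scaleR_add_left [symmetric])
  then have "norm (radial_power a b x - radial_power a b (- x)) = 2 * r powr a"
    using r by (simp add: radial_profile_def r_def [symmetric])
  moreover have "norm (radial_power a b x - radial_power a b (stretch_point x (- x))) = r powr a * (3 powr a - 1)"
    unfolding radial_power_stretch_dist [OF assms(1-3)] d r_def [symmetric]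
    using r by (simp add: radial_profile_def powr_mult algebra_simps)
  ultimately show ?thesis using r by (simp add: distortion_quot_def)
qed

lemma distortion_const_eq:
  assumes "0 < a" "a \<le> 1" "1 \<le> b"
  shows "distortion_const TYPE('n::finite) a b = ereal (2 / (3 powr a - 1))"
  unfolding distortion_const_def
proof (rule antisym)
  show "Sup {ereal (distortion_quot a b x y) | (x :: real ^ 'n) (y :: real ^ 'n).
            x \<noteq> 0 \<and> y \<noteq> 0 \<and> x \<noteq> y \<and> norm x \<le> norm y} \<le> ereal (2 / (3 powr a - 1))"
    using assms by (intro Sup_least) (auto intro: distortion_quot_le)
next
  define x :: "real ^ 'n" where "x = (1 / 4) *\<^sub>R axis undefined 1"
  have n: "norm x = 1 / 4" by (simp add: x_def)
  then have x: "x \<noteq> 0" by auto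
  then have "x + x \<noteq> 0" by (metis scaleR_2 scaleR_eq_0_iff zero_neq_numeral)
  then have "x \<noteq> - x" by (simp add: eq_neg_iff_add_eq_0)
  have "ereal (2 / (3 powr a - 1)) = ereal (distortion_quot a b x (- x))"
    using distortion_quot_antipodal [of a b x] assms n x by simp
  then show "ereal (2 / (3 powr a - 1)) \<le> Sup {ereal (distortion_quot a b x y) | (x :: real ^ 'n) (y :: real ^ 'n).
            x \<noteq> 0 \<and> y \<noteq> 0 \<and> x \<noteq> y \<and> norm x \<le> norm y}"
    using x \<open>x \<noteq> - x\<close> by (intro Sup_upper CollectI exI [of _ x] exI [of _ "- x"]) simp
qed

theorem theorem1p6:
  fixes a b :: real
  assumes "0 < a" and "a \<le> 1" and "1 \<le> b"
  shows "distortion_const TYPE('n::finite) a b = ereal (2 / (3 powr a - 1)) \<and>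
    ((\<lambda>a'. distortion_const TYPE('n) a' b) \<longlongrightarrow> 1) (at 1 within {0<..1})"
proof
  show "distortion_const TYPE('n) a b = ereal (2 / (3 powr a - 1))"
    using assms by (rule distortion_const_eq)
  have "((\<lambda>a'::real. 2 / (3 powr a' - 1)) \<longlongrightarrow> 2 / (3 powr 1 - 1)) (at 1 within {0<..1})"
    by (intro tendsto_intros) auto
  then have "((\<lambda>a'::real. ereal (2 / (3 powr a' - 1))) \<longlongrightarrow> 1) (at 1 within {0<..1})"
    by (simp add: one_ereal_def)
  moreover have "eventually (\<lambda>a'. ereal (2 / (3 powr a' - 1)) = distortion_const TYPE('n) a' b)
      (at 1 within {0<..1})"
    using assms(3) by (auto simp: eventually_at_filter distortion_const_eq)
  ultimately show "((\<lambda>a'. distortion_const TYPE('n) a' b) \<longlongrightarrow> 1) (at 1 within {0<..1})"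
    by (rule Lim_transform_eventually)
qed

end
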